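(* Let $e_1<e_2<e_3<e_4$ be distinct reals and $h>0$. For $\mathbf L\in M_h$ let $(\eta_1,\eta_2)=(\eta_1(\mathbf L),\eta_2(\mathbf L))$, let $r_1\le r_2$ be the roots of $R(z)=2hz^2-\eta_1z+\eta_2$, let $A(z)=\prod_{k=1}^4(z-e_k)$, $p(s)=\sqrt{-R(s)/(4A(s))}$, and define the action map $\mathbf L\mapsto(J_1,J_2,J_3)$ by $$J_1=\frac2\pi\int_{e_1}^{\min(r_1,e_2)}p\,ds,\quad J_2=\frac2\pi\int_{\max(r_1,e_2)}^{\min(r_2,e_3)}p\,ds,\quad J_3=\frac2\pi\int_{\max(r_2,e_3)}^{e_4}p\,ds.$$ Then the image of $M_h$ under this action map is the equilateral triangle $\mathcal T=\{(J_1,J_2,J_3)\in\mathbb R^3: J_1,J_2,J_3\ge0,\ J_1+J_2+J_3=\sqrt{2h}\}$.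
   Context: $M_h=\{\mathbf L=(\ell_{12},\ell_{13},\ell_{14},\ell_{23},\ell_{24},\ell_{34})\in\mathbb R^6:\sum_{i<j}\ell_{ij}^2=2h,\ \ell_{12}\ell_{34}-\ell_{13}\ell_{24}+\ell_{14}\ell_{23}=0\}\cong S^2\times S^2$ (a symplectic leaf of $\mathfrak{so}(4)^*$), and $\eta_1=\sum_{i<j}\ell_{ij}^2\sum_{k\ne i,j}e_k$, $\eta_2=\sum_{i<j}\ell_{ij}^2\prod_{k\ne i,j}e_k$. For $\mathbf L\in M_h$ the roots $r_1\le r_2$ are real and lie in $[e_1,e_4]$. *)

theory Defs
  imports "HOL-Analysis.Analysis"
begin

type_synonym vec6 = "real \<times> real \<times> real \<times> real \<times> real \<times> real"

definition Mh :: "real \<Rightarrow> vec6 set" where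
  "Mh h = {(l12, l13, l14, l23, l24, l34).
      l12\<^sup>2 + l13\<^sup>2 + l14\<^sup>2 + l23\<^sup>2 + l24\<^sup>2 + l34\<^sup>2 = 2 * h \<and>
      l12 * l34 - l13 * l24 + l14 * l23 = 0}"

definition eta1 :: "real \<Rightarrow> real \<Rightarrow> real \<Rightarrow> real \<Rightarrow> vec6 \<Rightarrow> real" where
  "eta1 e1 e2 e3 e4 L = (case L of (l12, l13, l14, l23, l24, l34) \<Rightarrow>
      l12\<^sup>2 * (e3 + e4) + l13\<^sup>2 * (e2 + e4) + l14\<^sup>2 * (e2 + e3)
    + l23\<^sup>2 * (e1 + e4) + l24\<^sup>2 * (e1 + e3) + l34\<^sup>2 * (e1 + e2))"

definition eta2 :: "real \<Rightarrow> real \<Rightarrow> real \<Rightarrow> real \<Rightarrow> vec6 \<Rightarrow> real" where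
  "eta2 e1 e2 e3 e4 L = (case L of (l12, l13, l14, l23, l24, l34) \<Rightarrow>
      l12\<^sup>2 * (e3 * e4) + l13\<^sup>2 * (e2 * e4) + l14\<^sup>2 * (e2 * e3)
    + l23\<^sup>2 * (e1 * e4) + l24\<^sup>2 * (e1 * e3) + l34\<^sup>2 * (e1 * e2))"

definition Rpoly :: "real \<Rightarrow> real \<Rightarrow> real \<Rightarrow> real \<Rightarrow> real" where
  "Rpoly h n1 n2 z = 2 * h * z\<^sup>2 - n1 * z + n2"

definition root1 :: "real \<Rightarrow> real \<Rightarrow> real \<Rightarrow> real" where
  "root1 h n1 n2 = (n1 - sqrt (n1\<^sup>2 - 8 * h * n2)) / (4 * h)"

definition root2 :: "real \<Rightarrow> real \<Rightarrow> real \<Rightarrow> real" where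
  "root2 h n1 n2 = (n1 + sqrt (n1\<^sup>2 - 8 * h * n2)) / (4 * h)"

definition Apoly :: "real \<Rightarrow> real \<Rightarrow> real \<Rightarrow> real \<Rightarrow> real \<Rightarrow> real" where
  "Apoly e1 e2 e3 e4 z = (z - e1) * (z - e2) * (z - e3) * (z - e4)"

definition action_map :: "real \<Rightarrow> real \<Rightarrow> real \<Rightarrow> real \<Rightarrow> real \<Rightarrow> vec6 \<Rightarrow> real \<times> real \<times> real" where
  "action_map e1 e2 e3 e4 h L =
    (let n1 = eta1 e1 e2 e3 e4 L; n2 = eta2 e1 e2 e3 e4 L;
         r1 = root1 h n1 n2; r2 = root2 h n1 n2;
         p = (\<lambda>s. sqrt (- Rpoly h n1 n2 s / (4 * Apoly e1 e2 e3 e4 s)))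
     in ( 2 / pi * integral {e1 .. min r1 e2} p,
          2 / pi * integral {max r1 e2 .. min r2 e3} p,
          2 / pi * integral {max r2 e3 .. e4} p))"

definition triangle :: "real \<Rightarrow> (real \<times> real \<times> real) set" where
  "triangle h = {(J1, J2, J3). J1 \<ge> 0 \<and> J2 \<ge> 0 \<and> J3 \<ge> 0 \<and> J1 + J2 + J3 = sqrt (2 * h)}"

end

theory Submission
  imports Defs "HOL-Complex_Analysis.Complex_Analysis"
begin

text \<open>
  A point of \<open>Mh h\<close> is a plane in four-space, and \<open>R / (2h)\<close> is the characteristic polynomial of
  the compression of \<open>diag(e1, e2, e3, e4)\<close> to the orthogonal plane. Hence the pairs \<open>(r1, r2)\<close>
  that occur are exactly those with \<open>e1 \<le> r1 \<le> e3\<close>, \<open>e2 \<le> r2 \<le> e4\<close> and \<open>r1 \<le> r2\<close>.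

  For such a pair, \<open>f(z) = sqrt ((z - r1) (z - r2) / A(z))\<close> has a branch on the upper half plane
  with \<open>f(z) \<sim> 1/z\<close> at infinity, whose boundary values on the real line have imaginary part
  \<open>- sqrt (- (x - r1) (x - r2) / A(x))\<close> on the three bands and \<open>0\<close> elsewhere. Cauchy's theorem
  therefore gives \<open>\<pi>\<close> for the total integral over the bands, that is \<open>J1 + J2 + J3 = sqrt (2h)\<close>.

  The actions depend continuously on \<open>(r1, r2)\<close>, and the boundary of the parameter region is mapped
  to the boundary of the triangle edge by edge; by Brouwer's fixed point theorem every point of the
  triangle is attained.
\<close>

section \<open>A boundary integral in the upper half plane\<close>

text \<open>The antiderivative \<open>2 * sgn (x - c) * sqrt \<bar>x - c\<bar>\<close> is continuous
  across \<open>c\<close>, so the fundamental theorem applies with \<open>c\<close> as the only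
  exceptional point.\<close>

lemma inverse_sqrt_abs_integrable:
  fixes a b c :: real
  shows "(\<lambda>x. 1 / sqrt \<bar>x - c\<bar>) integrable_on {a..b}"
proof (cases "a \<le> b")
  case True
  let ?F = "\<lambda>x. 2 * sgn (x - c) * sqrt \<bar>x - c\<bar>"
  have eq: "?F = (\<lambda>x. 2 * (sqrt (max 0 (x - c)) - sqrt (max 0 (c - x))))"
    by (rule ext) (auto simp: sgn_if max_def)
  have "((\<lambda>x. 1 / sqrt \<bar>x - c\<bar>) has_integral (?F b - ?F a)) {a..b}"
  proof (rule fundamental_theorem_of_calculus_interior_strong[where S = "{c}"])
    show "continuous_on {a..b} ?F"
      unfolding eq by (intro continuous_intros)
    fix x assume x: "x \<in> {a<..<b} - {c}"
    show "(?F has_vector_derivative 1 / sqrt \<bar>x - c\<bar>) (at x)"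
    proof (cases "x > c")
      case True
      have "((\<lambda>x. 2 * sqrt (x - c)) has_real_derivative 1 / sqrt \<bar>x - c\<bar>) (at x)"
        using True by (auto intro!: derivative_eq_intros simp: field_simps)
      moreover have "\<forall>\<^sub>F y in nhds x. ?F y = 2 * sqrt (y - c)"
        using eventually_nhds_in_open[of "{c<..}" x] True
        by (auto elim!: eventually_mono)
      ultimately show ?thesis
        by (subst has_real_derivative_iff_has_vector_derivative [symmetric])
           (subst DERIV_cong_ev[OF refl _ refl], auto)
    next
      case False
      with x have xc: "x < c" by auto
      have "((\<lambda>x. - 2 * sqrt (c - x)) has_real_derivative 1 / sqrt \<bar>x - c\<bar>) (at x)"
        using xc by (auto intro!: derivative_eq_intros simp: field_simps)
      moreover have "\<forall>\<^sub>F y in nhds x. ?F y = - 2 * sqrt (c - y)"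
        using eventually_nhds_in_open[of "{..<c}" x] xc
        by (auto elim!: eventually_mono)
      ultimately show ?thesis
        by (subst has_real_derivative_iff_has_vector_derivative [symmetric])
           (subst DERIV_cong_ev[OF refl _ refl], auto)
    qed
  qed (use True in auto)
  then show ?thesis by blast
qed auto

text \<open>\<open>csqrt\<close> jumps across the negative real axis, but on the closed upper half
  plane its half-angle formula has no sign switch and is continuous there.\<close>

lemma csqrt_tendsto_from_above:
  fixes x a :: real
  shows "(\<lambda>n. csqrt (Complex x (1 / real (Suc n)) - of_real a)) \<longlonglongrightarrow> csqrt (of_real (x - a))"
proof -
  let ?z = "\<lambda>n. Complex x (1 / real (Suc n)) - of_real a"
  have "(\<lambda>n. 1 / real (Suc n)) \<longlonglongrightarrow> 0" 
    using LIMSEQ_inverse_real_of_nat by (simp add: inverse_eq_divide)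
  then have z: "?z \<longlonglongrightarrow> of_real (x - a)"
    by (auto simp: tendsto_complex_iff)
  have eq: "csqrt w = Complex (sqrt ((cmod w + Re w) / 2)) (sqrt ((cmod w - Re w) / 2))"
    if "Im w \<ge> 0" for w
    using that by (auto simp: complex_eq_iff sgn_if)
  have "(\<lambda>n. Complex (sqrt ((cmod (?z n) + Re (?z n)) / 2)) (sqrt ((cmod (?z n) - Re (?z n)) / 2)))
     \<longlonglongrightarrow> Complex (sqrt ((cmod (of_real (x - a)) + Re (of_real (x - a))) / 2))
          (sqrt ((cmod (of_real (x - a)) - Re (of_real (x - a))) / 2))"
    using z by (intro tendsto_intros) auto
  then show ?thesis
    by (subst eq, simp, subst eq, simp)
qed

text \<open>The integral of \<open>f\<close> along a horizontal segment is the increment of a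
  primitive \<open>F\<close>. After subtracting a primitive of \<open>1 / z\<close>, the increment
  can be estimated along a path far from the origin, where it is small, while the logarithm
  contributes \<open>- pi\<close> to the imaginary part. The majorants \<open>W\<close> allow the
  segment to descend to the real axis.\<close>

lemma upper_half_plane_boundary_integral:
  fixes f :: "complex \<Rightarrow> complex" and g :: "real \<Rightarrow> complex" and W :: "real \<Rightarrow> real \<Rightarrow> real"
  assumes hol: "f holomorphic_on {z. Im z > 0}"
    and asym: "\<And>\<epsilon>. \<epsilon> > 0 \<Longrightarrow> \<exists>R. \<forall>z. Im z > 0 \<longrightarrow> cmod z \<ge> R \<longrightarrow> cmod (z * f z - 1) \<le> \<epsilon>"
    and E: "finite E"
    and W: "\<And>\<rho>. W \<rho> integrable_on {-\<rho>..\<rho>}"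
    and bound: "\<And>\<rho> x y. x \<notin> E \<Longrightarrow> \<bar>x\<bar> \<le> \<rho> \<Longrightarrow> 0 < y \<Longrightarrow> y \<le> 1 \<Longrightarrow> cmod (f (Complex x y)) \<le> W \<rho> x"
    and lim: "\<And>x. x \<notin> E \<Longrightarrow> (\<lambda>n. f (Complex x (1 / real (Suc n)))) \<longlonglongrightarrow> g x"
    and out: "\<And>x. x \<notin> E \<Longrightarrow> x \<notin> {a..b} \<Longrightarrow> Im (g x) = 0"
  shows "((\<lambda>x. - Im (g x)) has_integral pi) {a..b}"
proof -
  define H where "H = {z::complex. Im z > 0}"
  have H: "convex H" "open H"
    by (auto simp: H_def convex_halfspace_Im_gt open_halfspace_Im_gt)
  obtain F where F': "\<And>z. z \<in> H \<Longrightarrow> (F has_field_derivative f z) (at z within H)"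
    using holomorphic_convex_primitive'[OF H] hol unfolding H_def by blast
  have F: "(F has_field_derivative f z) (at z)" if "z \<in> H" for z
    using F'[OF that] at_within_open[OF that H(2)] by simp
  \<comment> \<open>Rotating by \<open>-\<i>\<close> moves the branch cut of the logarithm off the closed upper half plane.\<close>
  define G where "G = (\<lambda>z. F z - Ln (- \<i> * z))"
  have G: "(G has_field_derivative (f z - 1 / z)) (at z)" if "z \<in> H" for z
  proof -
    have "- \<i> * z \<notin> \<real>\<^sub>\<le>\<^sub>0" "z \<noteq> 0"
      using that by (auto simp: H_def complex_nonpos_Reals_iff)
    then show ?thesis
      unfolding G_def using F[OF that]
      by (auto intro!: derivative_eq_intros simp: field_simps)
  qed
  \<comment> \<open>With the value 0 on \<open>E\<close>, convergence and domination below hold at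
    every point.\<close>
  define g' where "g' = (\<lambda>x. if x \<in> E then 0 else Im (g x))"
  define \<delta> where "\<delta> = (\<lambda>n. 1 / real (Suc n))"
  have \<delta>: "\<delta> \<longlonglongrightarrow> 0" "0 < \<delta> n" "\<delta> n \<le> 1" for n
    using LIMSEQ_inverse_real_of_nat by (auto simp: \<delta>_def inverse_eq_divide)
  have FTC: "((\<lambda>x. Im (f (Complex x y))) has_integral Im (F (Complex \<rho> y) - F (Complex (-\<rho>) y))) {-\<rho>..\<rho>}"
    if "y > 0" "\<rho> \<ge> 0" for y \<rho>
  proof -
    have "((\<lambda>x. f (Complex x y)) has_integral (F (Complex \<rho> y) - F (Complex (-\<rho>) y))) {-\<rho>..\<rho>}"
    proof (rule fundamental_theorem_of_calculus)
      fix x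
      have "((\<lambda>x. of_real x + \<i> * of_real y) has_vector_derivative 1) (at x within {-\<rho>..\<rho>})"
        by (auto intro!: derivative_eq_intros)
      then have "((\<lambda>x. Complex x y) has_vector_derivative 1) (at x within {-\<rho>..\<rho>})"
        by (simp add: Complex_eq)
      moreover have "(F has_field_derivative f (Complex x y)) (at (Complex x y) within (\<lambda>x. Complex x y) ` {-\<rho>..\<rho>})"
        using that by (auto simp: H_def intro: has_field_derivative_at_within[OF F])
      ultimately show "((\<lambda>x. F (Complex x y)) has_vector_derivative f (Complex x y)) (at x within {-\<rho>..\<rho>})"
        using field_vector_diff_chain_within[of "\<lambda>x. Complex x y" 1 x "{-\<rho>..\<rho>}" F "f (Complex x y)"]
        by (simp add: o_def)
    qed (use that in auto)
    from has_integral_linear[OF this bounded_linear_Im] show ?thesis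
      by (simp add: o_def)
  qed
  have step: "g' integrable_on {-\<rho>..\<rho>}"
    "(\<lambda>n. Im (F (Complex \<rho> (\<delta> n)) - F (Complex (-\<rho>) (\<delta> n)))) \<longlonglongrightarrow> integral {-\<rho>..\<rho>} g'"
    if \<rho>: "\<rho> \<ge> 0" for \<rho>
  proof -
    define h where "h = (\<lambda>n x. if x \<in> E then 0 else Im (f (Complex x (\<delta> n))))"
    define w where "w = (\<lambda>x. if x \<in> E then 0 else W \<rho> x)"
    have h: "(h n has_integral Im (F (Complex \<rho> (\<delta> n)) - F (Complex (-\<rho>) (\<delta> n)))) {-\<rho>..\<rho>}" for n
      using has_integral_spike_finite[OF E _ FTC[OF \<delta>(2) \<rho>], of "h n" n] by (auto simp: h_def)
    have w: "w integrable_on {-\<rho>..\<rho>}"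
      using integrable_spike_finite[OF E _ W, of \<rho> w] by (auto simp: w_def)
    have le: "norm (h n x) \<le> w x" if "x \<in> {-\<rho>..\<rho>}" for n x
      using that bound[of x \<rho> "\<delta> n"] \<delta>(2,3)[of n]
        order_trans[OF abs_Im_le_cmod[of "f (Complex x (\<delta> n))"], of "W \<rho> x"]
      by (simp add: h_def w_def abs_le_iff)
    have conv: "(\<lambda>n. h n x) \<longlonglongrightarrow> g' x" for x
      using tendsto_Im[OF lim[of x]] by (auto simp: h_def g'_def \<delta>_def)
    note dc = dominated_convergence[of h "{-\<rho>..\<rho>}" w g', OF has_integral_integrable[OF h] w le conv]
    show "g' integrable_on {-\<rho>..\<rho>}" by (rule dc(1))
    show "(\<lambda>n. Im (F (Complex \<rho> (\<delta> n)) - F (Complex (-\<rho>) (\<delta> n)))) \<longlonglongrightarrow> integral {-\<rho>..\<rho>} g'"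
      using dc(2) by (simp add: integral_unique[OF h])
  qed
  \<comment> \<open>As \<open>g'\<close> vanishes off \<open>{a..b}\<close>, its integral over
    \<open>{-\<rho>..\<rho>}\<close> no longer depends on \<rho> once \<rho> is large.\<close>
  have ab: "(g' has_integral integral {-\<rho>..\<rho>} g') {a..b}" if "\<rho> \<ge> \<bar>a\<bar>" "\<rho> \<ge> \<bar>b\<bar>" for \<rho>
  proof -
    have sub: "{a..b} \<subseteq> {-\<rho>..\<rho>}" using that by auto
    have "g' = (\<lambda>x. if x \<in> {a..b} then g' x else 0)"
      using out by (auto simp: g'_def)
    moreover have "(g' has_integral integral {-\<rho>..\<rho>} g') {-\<rho>..\<rho>}"
      using step(1)[of \<rho>] that by (simp add: integrable_integral)
    ultimately show ?thesis
      using has_integral_restrict[OF sub, of g'] by metis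
  qed
  have close: "\<bar>integral {a..b} g' + pi\<bar> \<le> 4 * \<epsilon>" if \<epsilon>: "\<epsilon> > 0" for \<epsilon>
  proof -
    obtain R where R: "\<And>z. Im z > 0 \<Longrightarrow> cmod z \<ge> R \<Longrightarrow> cmod (z * f z - 1) \<le> \<epsilon>"
      using asym[OF \<epsilon>] by blast
    define \<rho> where "\<rho> = Max {1, R, \<bar>a\<bar>, \<bar>b\<bar>}"
    have \<rho>: "\<rho> \<ge> 1" "\<rho> \<ge> R" "\<rho> \<ge> \<bar>a\<bar>" "\<rho> \<ge> \<bar>b\<bar>"
      by (simp_all add: \<rho>_def le_max_iff_disj)
    have G': "cmod (f z - 1 / z) \<le> \<epsilon> / \<rho>" if "Im z > 0" "cmod z \<ge> \<rho>" for z
    proof -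
      have "z \<noteq> 0" using that by auto
      then have "f z - 1 / z = (z * f z - 1) / z" by (simp add: field_simps)
      then have "cmod (f z - 1 / z) = cmod (z * f z - 1) / cmod z" by (simp add: norm_divide)
      also have "\<dots> \<le> \<epsilon> / \<rho>"
        using that R[of z] \<rho> \<epsilon> by (intro frac_le) auto
      finally show ?thesis .
    qed
    have path: "cmod (G u - G v) \<le> \<epsilon> / \<rho> * cmod (u - v)"
      if "convex S" "u \<in> S" "v \<in> S" "\<And>z. z \<in> S \<Longrightarrow> Im z > 0 \<and> cmod z \<ge> \<rho>" for u v S
      using that G' G by (intro field_differentiable_bound[where S = S and f' = "\<lambda>z. f z - 1 / z"])
        (auto simp: H_def intro: has_field_derivative_at_within[OF G])
    have vert: "convex {z. Re z = c \<and> Im z > 0}" for c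
    proof -
      have "{z. Re z = c \<and> Im z > 0} = {z. Re z \<ge> c} \<inter> {z. Re z \<le> c} \<inter> {z. Im z > 0}" by auto
      then show ?thesis
        by (simp add: convex_Int convex_halfspace_Re_ge convex_halfspace_Re_le convex_halfspace_Im_gt)
    qed
    have horiz: "convex {z. Im z = c}" for c
    proof -
      have "{z. Im z = c} = {z. Im z \<ge> c} \<inter> {z. Im z \<le> c}" by auto
      then show ?thesis
        by (simp add: convex_Int convex_halfspace_Im_ge convex_halfspace_Im_le)
    qed
    \<comment> \<open>The endpoints are joined by the other three sides of a rectangle of height
      \<rho>. These sides stay at distance at least \<rho> from 0, where the derivative of
      \<open>G\<close> is at most \<open>\<epsilon> / \<rho>\<close>, and their total length is at
      most \<open>4 * \<rho>\<close> because \<open>y \<le> 1 \<le> \<rho>\<close>.\<close>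
    have Gdiff: "cmod (G (Complex \<rho> y) - G (Complex (-\<rho>) y)) \<le> 4 * \<epsilon>" if y: "0 < y" "y \<le> 1" for y
    proof -
      have 1: "cmod (G (Complex \<rho> y) - G (Complex \<rho> \<rho>)) \<le> \<epsilon> / \<rho> * cmod (Complex \<rho> y - Complex \<rho> \<rho>)"
        using y \<rho> abs_Re_le_cmod by (intro path[OF vert[of \<rho>]]) (auto, smt (verit))
      have 2: "cmod (G (Complex \<rho> \<rho>) - G (Complex (-\<rho>) \<rho>)) \<le> \<epsilon> / \<rho> * cmod (Complex \<rho> \<rho> - Complex (-\<rho>) \<rho>)"
        using y \<rho> abs_Im_le_cmod by (intro path[OF horiz[of \<rho>]]) (auto, smt (verit))
      have 3: "cmod (G (Complex (-\<rho>) \<rho>) - G (Complex (-\<rho>) y)) \<le> \<epsilon> / \<rho> * cmod (Complex (-\<rho>) \<rho> - Complex (-\<rho>) y)"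
        using y \<rho> abs_Re_le_cmod by (intro path[OF vert[of "-\<rho>"]]) (auto, smt (verit))
      have l: "cmod (Complex \<rho> y - Complex \<rho> \<rho>) \<le> \<rho>" "cmod (Complex \<rho> \<rho> - Complex (-\<rho>) \<rho>) \<le> 2 * \<rho>"
        "cmod (Complex (-\<rho>) \<rho> - Complex (-\<rho>) y) \<le> \<rho>"
        using y \<rho> by (auto simp: cmod_def real_sqrt_mult)
      have "cmod (G (Complex \<rho> y) - G (Complex (-\<rho>) y)) \<le> cmod (G (Complex \<rho> y) - G (Complex \<rho> \<rho>))
        + cmod (G (Complex \<rho> \<rho>) - G (Complex (-\<rho>) \<rho>)) + cmod (G (Complex (-\<rho>) \<rho>) - G (Complex (-\<rho>) y))"
        by norm
      also have "\<dots> \<le> \<epsilon> / \<rho> * \<rho> + \<epsilon> / \<rho> * (2 * \<rho>) + \<epsilon> / \<rho> * \<rho>"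
        using \<epsilon> \<rho> by (intro add_mono order_trans[OF 1] order_trans[OF 2] order_trans[OF 3] mult_left_mono l) auto
      also have "\<dots> = 4 * \<epsilon>" using \<rho> by (simp add: field_simps)
      finally show ?thesis .
    qed
    have L: "(\<lambda>n. Ln (- \<i> * Complex c (\<delta> n))) \<longlonglongrightarrow> Ln (- \<i> * of_real c)" if "c \<noteq> 0" for c
    proof (rule tendsto_Ln)
      show "(\<lambda>n. - \<i> * Complex c (\<delta> n)) \<longlonglongrightarrow> - \<i> * of_real c"
        using \<delta>(1) by (intro tendsto_intros) (auto simp: tendsto_complex_iff)
      show "- \<i> * of_real c \<notin> \<real>\<^sub>\<le>\<^sub>0" using that by (auto simp: complex_nonpos_Reals_iff)
    qed
    \<comment> \<open>The argument of \<open>- \<i> * z\<close> runs from \<open>pi / 2\<close> at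
      \<open>-\<rho>\<close> to \<open>- pi / 2\<close> at \<open>\<rho>\<close>. This is the source
      of the value \<open>pi\<close>.\<close>
    have Lr: "Im (Ln (- \<i> * of_real \<rho>)) = - pi / 2" "Im (Ln (- \<i> * of_real (-\<rho>))) = pi / 2"
      using \<rho> Ln_times_of_real[of \<rho> "-\<i>"] Ln_times_of_real[of \<rho> "\<i>"] by (auto simp: mult.commute)
    have "(\<lambda>n. Im (F (Complex \<rho> (\<delta> n)) - F (Complex (-\<rho>) (\<delta> n)))
          - (Im (Ln (- \<i> * Complex \<rho> (\<delta> n))) - Im (Ln (- \<i> * Complex (-\<rho>) (\<delta> n)))))
       \<longlonglongrightarrow> integral {-\<rho>..\<rho>} g' - (Im (Ln (- \<i> * of_real \<rho>)) - Im (Ln (- \<i> * of_real (-\<rho>))))"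
      using \<rho> by (intro tendsto_diff step(2) tendsto_Im L) auto
    then have lim0: "(\<lambda>n. Im (G (Complex \<rho> (\<delta> n)) - G (Complex (-\<rho>) (\<delta> n)))) \<longlonglongrightarrow> integral {-\<rho>..\<rho>} g' + pi"
      unfolding Lr by (simp add: G_def algebra_simps)
    have "\<bar>integral {-\<rho>..\<rho>} g' + pi\<bar> \<le> 4 * \<epsilon>"
      using order_trans[OF abs_Im_le_cmod Gdiff[OF \<delta>(2,3)]]
      by (rule_tac tendsto_upperbound[OF tendsto_rabs[OF lim0]]) auto
    then show ?thesis using integral_unique[OF ab[OF \<rho>(3,4)]] by simp
  qed
  have "integral {a..b} g' = - pi"
  proof (rule ccontr)
    assume "integral {a..b} g' \<noteq> - pi"
    then have "\<bar>integral {a..b} g' + pi\<bar> > 0" by auto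
    with close[of "\<bar>integral {a..b} g' + pi\<bar> / 8"] show False by auto
  qed
  moreover have "g' integrable_on {a..b}"
    by (rule has_integral_integrable[OF ab[of "max \<bar>a\<bar> \<bar>b\<bar>"]]) auto
  ultimately have "(g' has_integral - pi) {a..b}"
    by (metis integrable_integral)
  then have "((\<lambda>x. - g' x) has_integral pi) {a..b}"
    using has_integral_neg[of g' "- pi"] by simp
  then show ?thesis
    using has_integral_spike_finite[OF E, of "{a..b}" "\<lambda>x. - Im (g x)" "\<lambda>x. - g' x"] by (auto simp: g'_def)
qed

section \<open>The density on the bands\<close>

text \<open>After clearing denominators this is the triangle inequality combined with subadditivity
  of the square root. At \<open>x = a\<close> or \<open>x = b\<close> the left-hand side is 0, since
  \<open>1 / 0 = 0\<close>. Its purpose is to replace a product of singularities by a sum.\<close>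

lemma inverse_sqrt_abs_mult_le:
  fixes a b x :: real
  assumes "a \<noteq> b"
  shows "1 / sqrt \<bar>x - a\<bar> * (1 / sqrt \<bar>x - b\<bar>) \<le> 1 / sqrt \<bar>a - b\<bar> * (1 / sqrt \<bar>x - a\<bar> + 1 / sqrt \<bar>x - b\<bar>)"
proof (cases "x = a \<or> x = b")
  case False
  have "sqrt \<bar>a - b\<bar> \<le> sqrt (\<bar>x - a\<bar> + \<bar>x - b\<bar>)" by simp
  also have "\<dots> \<le> sqrt \<bar>x - a\<bar> + sqrt \<bar>x - b\<bar>" by (rule sqrt_add_le_add_sqrt) auto
  finally have le: "sqrt \<bar>a - b\<bar> \<le> sqrt \<bar>x - a\<bar> + sqrt \<bar>x - b\<bar>" .
  have pos: "sqrt \<bar>a - b\<bar> > 0" "sqrt \<bar>x - a\<bar> > 0" "sqrt \<bar>x - b\<bar> > 0"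
    using assms False by auto
  have "1 / p * (1 / q) \<le> 1 / m * (1 / p + 1 / q)" if "m \<le> p + q" "m > 0" "p > 0" "q > 0" for m p q :: real
    using that by (simp add: divide_simps add.commute)
  from this[OF le pos] show ?thesis .
qed auto

text \<open>The four singularities sit at distinct points, so splitting products twice leaves a
  linear combination of single inverse square roots, each integrable.\<close>

lemma inverse_sqrt_Apoly_dominated:
  assumes "e1 < e2" "e2 < e3" "e3 < e4"
  obtains W where "\<And>a b. W integrable_on {a..b}" "\<And>x. 1 / sqrt \<bar>Apoly e1 e2 e3 e4 x\<bar> \<le> W x"
proof -
  define s where "s = (\<lambda>a x. 1 / sqrt \<bar>x - a\<bar> :: real)"
  define k where "k = (\<lambda>a b. 1 / sqrt \<bar>a - b\<bar> :: real)"
  have k0: "k a b \<ge> 0" and s0: "s a x \<ge> 0" for a b x by (auto simp: k_def s_def)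
  have int: "s a integrable_on {u..v}" for a u v
    unfolding s_def by (rule inverse_sqrt_abs_integrable)
  have pair: "s a x * s b x \<le> k a b * (s a x + s b x)" if "a \<noteq> b" for a b x
    unfolding s_def k_def using that by (rule inverse_sqrt_abs_mult_le)
  define W where "W = (\<lambda>x. k e1 e2 * k e3 e4 *
    (k e1 e3 * (s e1 x + s e3 x) + k e1 e4 * (s e1 x + s e4 x)
     + k e2 e3 * (s e2 x + s e3 x) + k e2 e4 * (s e2 x + s e4 x)))"
  have "W integrable_on {u..v}" for u v
    unfolding W_def by (intro integrable_add integrable_on_mult_right int)
  moreover have "1 / sqrt \<bar>Apoly e1 e2 e3 e4 x\<bar> \<le> W x" for x
  proof -
    have "1 / sqrt \<bar>Apoly e1 e2 e3 e4 x\<bar> = (s e1 x * s e2 x) * (s e3 x * s e4 x)"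
      by (simp add: Apoly_def s_def abs_mult real_sqrt_mult)
    also have "\<dots> \<le> (k e1 e2 * (s e1 x + s e2 x)) * (k e3 e4 * (s e3 x + s e4 x))"
      using assms by (intro mult_mono pair) (auto intro!: mult_nonneg_nonneg add_nonneg_nonneg k0 s0)
    also have "\<dots> = k e1 e2 * k e3 e4 * (s e1 x * s e3 x + s e1 x * s e4 x + s e2 x * s e3 x + s e2 x * s e4 x)"
      by (simp add: algebra_simps)
    also have "\<dots> \<le> W x"
      unfolding W_def using assms
      by (intro mult_left_mono add_mono pair) (auto intro!: mult_nonneg_nonneg k0)
    finally show ?thesis .
  qed
  ultimately show ?thesis using that by blast
qed

text \<open>On the upper half plane \<open>csqrt\<close> takes values in the open first quadrant, so
  the quotient has positive real part. It is therefore the principal root of its square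
  \<open>1 - a / z\<close>, which tends to 1.\<close>

lemma csqrt_shift_quotient_tendsto_1:
  fixes a :: real
  shows "((\<lambda>z. csqrt (z - of_real a) / csqrt z) \<longlongrightarrow> 1) (inf at_infinity (principal {z. Im z > 0}))"
proof -
  have eq: "csqrt (z - of_real a) / csqrt z = csqrt (1 - of_real a / z)" if "Im z > 0" for z
  proof -
    have pos: "0 < Re (csqrt w)" "0 < Im (csqrt w)" if "Im w > 0" for w
    proof -
      have "0 < 2 * Re (csqrt w) * Im (csqrt w)"
        using that by (metis Im_power2 power2_csqrt)
      with Re_csqrt[of w] show "0 < Re (csqrt w)" "0 < Im (csqrt w)"
        by (auto simp: zero_less_mult_iff simp del: csqrt.simps)
    qed
    have "z \<noteq> 0" using that by auto
    have "0 < Re (csqrt (z - of_real a) / csqrt z)"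
      using pos[of z] pos[of "z - of_real a"] that
      by (auto simp: Re_divide intro!: divide_pos_pos add_pos_pos)
    moreover have "(csqrt (z - of_real a) / csqrt z)\<^sup>2 = 1 - of_real a / z"
      using \<open>z \<noteq> 0\<close> by (simp add: power_divide field_simps)
    ultimately show ?thesis by (metis csqrt_unique)
  qed
  have "((\<lambda>z. of_real a / z) \<longlongrightarrow> 0) (inf at_infinity (principal {z. Im z > 0}))"
    by (rule tendsto_mono[OF inf_le1 tendsto_divide_0[OF tendsto_const filterlim_ident]])
  then have "((\<lambda>z. csqrt (1 - of_real a / z)) \<longlongrightarrow> csqrt (1 - 0)) (inf at_infinity (principal {z. Im z > 0}))"
    by (intro isCont_tendsto_compose[OF continuous_at_csqrt] tendsto_intros) auto
  moreover have "\<forall>\<^sub>F z in inf at_infinity (principal {z. Im z > 0}).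
      csqrt (1 - of_real a / z) = csqrt (z - of_real a) / csqrt z"
    by (auto simp: eventually_inf_principal eq intro!: always_eventually)
  ultimately show ?thesis
    using tendsto_cong by fastforce
qed

section \<open>The square root branch on the upper half plane and the mass of the density\<close>

locale branch_points =
  fixes e1 e2 e3 e4 :: real
  assumes e12: "e1 < e2" and e23: "e2 < e3" and e34: "e3 < e4"
begin

text \<open>The integrand \<open>p\<close> of the actions without its factor
  \<open>sqrt (h / 2)\<close>. Truncation at 0 moves the dependence on the roots from the limits of
  integration into the integrand.\<close>

definition density :: "real \<Rightarrow> real \<Rightarrow> real \<Rightarrow> real" where
  "density r1 r2 s = sqrt (max 0 (- ((s - r1) * (s - r2)) / Apoly e1 e2 e3 e4 s))"

text \<open>The interlacing inequalities for the eigenvalues of the compression of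
  \<open>diag(e1, e2, e3, e4)\<close> to a plane.\<close>

definition admissible :: "real \<Rightarrow> real \<Rightarrow> bool" where
  "admissible r1 r2 \<longleftrightarrow> e1 \<le> r1 \<and> r1 \<le> e3 \<and> e2 \<le> r2 \<and> r2 \<le> e4 \<and> r1 \<le> r2"

text \<open>Principal roots are taken factor by factor: each factor is holomorphic on the upper half
  plane, whereas the principal root of the whole quotient could meet its cut.\<close>

definition resolvent :: "real \<Rightarrow> real \<Rightarrow> complex \<Rightarrow> complex" where
  "resolvent r1 r2 z = csqrt (z - of_real r1) * csqrt (z - of_real r2) /
     (csqrt (z - of_real e1) * csqrt (z - of_real e2) * csqrt (z - of_real e3) * csqrt (z - of_real e4))"

lemma density_nonneg: "density r1 r2 s \<ge> 0"
  by (simp add: density_def)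

lemma resolvent_holomorphic: "resolvent r1 r2 holomorphic_on {z. Im z > 0}"
  unfolding resolvent_def
  by (intro holomorphic_intros) (auto simp: complex_nonpos_Reals_iff)

text \<open>Dividing each of the six roots by \<open>csqrt z\<close> leaves two surplus factors
  \<open>csqrt z\<close> in the numerator, whose product is the factor \<open>z\<close>.\<close>

lemma resolvent_asymptotics:
  "((\<lambda>z. z * resolvent r1 r2 z) \<longlongrightarrow> 1) (inf at_infinity (principal {z. Im z > 0}))"
proof -
  let ?q = "\<lambda>a z. csqrt (z - of_real a) / csqrt z"
  have "((\<lambda>z. ?q r1 z * ?q r2 z / (?q e1 z * ?q e2 z * ?q e3 z * ?q e4 z)) \<longlongrightarrow> 1 * 1 / (1 * 1 * 1 * 1))
      (inf at_infinity (principal {z. Im z > 0}))"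
    by (intro tendsto_intros csqrt_shift_quotient_tendsto_1) auto
  moreover have "?q r1 z * ?q r2 z / (?q e1 z * ?q e2 z * ?q e3 z * ?q e4 z) = z * resolvent r1 r2 z"
    if "Im z > 0" for z
  proof -
    have nz: "csqrt (z - of_real a) \<noteq> 0" for a using that by auto
    have "csqrt z \<noteq> 0" using that by auto
    moreover have "z = csqrt z * csqrt z" by (metis power2_csqrt power2_eq_square)
    ultimately show ?thesis
      unfolding resolvent_def using nz[of e1] nz[of e2] nz[of e3] nz[of e4]
      by (simp add: divide_simps del: csqrt_eq_0 csqrt.simps)
  qed
  then have "\<forall>\<^sub>F z in inf at_infinity (principal {z. Im z > 0}).
      ?q r1 z * ?q r2 z / (?q e1 z * ?q e2 z * ?q e3 z * ?q e4 z) = z * resolvent r1 r2 z"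
    by (auto simp: eventually_inf_principal intro!: always_eventually)
  ultimately show ?thesis
    using tendsto_cong by fastforce
qed

lemma resolvent_limit:
  assumes "x \<notin> {e1, e2, e3, e4}"
  shows "(\<lambda>n. resolvent r1 r2 (Complex x (1 / real (Suc n)))) \<longlonglongrightarrow> resolvent r1 r2 (of_real x)"
  unfolding resolvent_def of_real_diff[symmetric] using assms
  by (intro tendsto_intros csqrt_tendsto_from_above) auto

text \<open>Moving off the real axis only increases the distances to the branch points, so the
  denominator is at least its boundary value. The constant bounds the distances to \<open>r1\<close>
  and \<open>r2\<close>.\<close>

lemma norm_resolvent_le:
  assumes "x \<notin> {e1, e2, e3, e4}" "\<bar>x\<bar> \<le> \<rho>" "0 < y" "y \<le> 1"
  shows "cmod (resolvent r1 r2 (Complex x y)) \<le> (\<rho> + 1 + \<bar>r1\<bar> + \<bar>r2\<bar>) * (1 / sqrt \<bar>Apoly e1 e2 e3 e4 x\<bar>)"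
proof -
  let ?K = "\<rho> + 1 + \<bar>r1\<bar> + \<bar>r2\<bar>"
  have num: "cmod (Complex x y - of_real r) \<le> ?K" if "r = r1 \<or> r = r2" for r
    using cmod_le[of "Complex x y - of_real r"] assms that by auto
  have den: "\<bar>x - e\<bar> \<le> cmod (Complex x y - of_real e)" for e
    using abs_Re_le_cmod[of "Complex x y - of_real e"] by simp
  have "sqrt (cmod (Complex x y - of_real r1)) * sqrt (cmod (Complex x y - of_real r2)) \<le> sqrt ?K * sqrt ?K"
    by (intro mult_mono real_sqrt_le_mono num) (use assms in auto)
  also have "\<dots> = ?K" using assms by auto
  finally have N: "sqrt (cmod (Complex x y - of_real r1)) * sqrt (cmod (Complex x y - of_real r2)) \<le> ?K" .
  have "sqrt \<bar>x - e1\<bar> * sqrt \<bar>x - e2\<bar> * sqrt \<bar>x - e3\<bar> * sqrt \<bar>x - e4\<bar> \<le>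
     sqrt (cmod (Complex x y - of_real e1)) * sqrt (cmod (Complex x y - of_real e2)) *
     sqrt (cmod (Complex x y - of_real e3)) * sqrt (cmod (Complex x y - of_real e4))"
    by (intro mult_mono real_sqrt_le_mono den) auto
  then have "cmod (resolvent r1 r2 (Complex x y)) \<le>
      ?K / (sqrt \<bar>x - e1\<bar> * sqrt \<bar>x - e2\<bar> * sqrt \<bar>x - e3\<bar> * sqrt \<bar>x - e4\<bar>)"
    unfolding resolvent_def norm_divide norm_mult norm_csqrt
    using assms by (intro frac_le N) (auto intro!: mult_pos_pos)
  then show ?thesis by (simp add: Apoly_def abs_mult real_sqrt_mult)
qed

text \<open>Each square root contributes the phase \<open>\<i>\<close> exactly when its branch point lies to the right of
  \<open>x\<close>; interlacing of the roots with the branch points rules out the total phase \<open>\<i>\<close>.\<close>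

lemma Im_resolvent_real:
  assumes "admissible r1 r2" "x \<notin> {e1, e2, e3, e4}"
  shows "Im (resolvent r1 r2 (of_real x)) = - density r1 r2 x"
proof -
  define u where "u = (\<lambda>t::real. if t \<ge> 0 then 1 else \<i>)"
  define Q where "Q = (x - r1) * (x - r2) / Apoly e1 e2 e3 e4 x"
  define P where "P = u (x - r1) * u (x - r2) / (u (x - e1) * u (x - e2) * u (x - e3) * u (x - e4))"
  have cs: "csqrt (of_real x - of_real a) = u (x - a) * of_real (sqrt \<bar>x - a\<bar>)" for a
  proof -
    have "csqrt (of_real (x - a)) = u (x - a) * of_real (sqrt \<bar>x - a\<bar>)"
      by (cases "x \<ge> a") (simp_all add: u_def del: of_real_diff csqrt.simps)
    then show ?thesis by simp
  qed
  have "resolvent r1 r2 (of_real x) = P * of_real (sqrt \<bar>x - r1\<bar> * sqrt \<bar>x - r2\<bar> /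
      (sqrt \<bar>x - e1\<bar> * sqrt \<bar>x - e2\<bar> * sqrt \<bar>x - e3\<bar> * sqrt \<bar>x - e4\<bar>))"
    unfolding resolvent_def cs P_def by (simp add: mult_ac)
  also have "\<dots> = P * of_real (sqrt \<bar>Q\<bar>)"
    by (simp add: Q_def Apoly_def abs_mult abs_divide real_sqrt_mult real_sqrt_divide)
  finally have eq: "Im (resolvent r1 r2 (of_real x)) = Im P * sqrt \<bar>Q\<bar>" by simp
  \<comment> \<open>If \<open>m\<close> roots and \<open>k\<close> branch points lie strictly to the
    right of \<open>x\<close>, then \<open>P\<close> is the power of \<i> with exponent
    \<open>m - k\<close>, and a nonzero \<open>Q\<close> has the sign of the same power of
    \<open>-1\<close>. Admissibility leaves only the exponents 0, -1 and -2.\<close>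
  have "P = - \<i> \<and> Q \<le> 0 \<or> Im P = 0 \<and> Q \<ge> 0"
  proof -
    consider "x < e1" | "e1 < x" "x < e2" | "e2 < x" "x < e3" | "e3 < x" "x < e4" | "e4 < x"
      using assms(2) by fastforce
    then show ?thesis
    proof cases
      case 1
      then have "u (x - r1) = \<i>" "u (x - r2) = \<i>" "u (x - e1) = \<i>" "u (x - e2) = \<i>" "u (x - e3) = \<i>" "u (x - e4) = \<i>"
        using assms e12 e23 e34 by (auto simp: u_def admissible_def)
      moreover have "Apoly e1 e2 e3 e4 x > 0" "(x - r1) * (x - r2) \<ge> 0"
        using 1 assms e12 e23 e34 by (auto simp: Apoly_def admissible_def zero_less_mult_iff mult_less_0_iff zero_le_mult_iff)
      ultimately show ?thesis by (auto simp: P_def Q_def)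
    next
      case 2
      then have u: "u (x - r2) = \<i>" "u (x - e1) = 1" "u (x - e2) = \<i>" "u (x - e3) = \<i>" "u (x - e4) = \<i>"
        using assms e12 e23 e34 by (auto simp: u_def admissible_def)
      have A: "Apoly e1 e2 e3 e4 x < 0" "x - r2 < 0"
        using 2 assms e12 e23 e34 by (auto simp: Apoly_def admissible_def zero_less_mult_iff mult_less_0_iff)
      show ?thesis
      proof (cases "x < r1")
        case True
        then have "u (x - r1) = \<i>" "(x - r1) * (x - r2) \<ge> 0" using A(2) by (auto simp: u_def zero_le_mult_iff)
        then show ?thesis using u A(1) by (auto simp: P_def Q_def divide_nonneg_neg)
      next
        case False
        then have "u (x - r1) = 1" "(x - r1) * (x - r2) \<le> 0" using A(2) by (auto simp: u_def mult_le_0_iff)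
        then show ?thesis using u A(1) by (auto simp: P_def Q_def divide_nonpos_neg)
      qed
    next
      case 3
      then have u: "u (x - e1) = 1" "u (x - e2) = 1" "u (x - e3) = \<i>" "u (x - e4) = \<i>"
        using assms e12 e23 e34 by (auto simp: u_def admissible_def)
      have A: "Apoly e1 e2 e3 e4 x > 0" "r1 \<le> r2"
        using 3 assms e12 e23 e34 by (auto simp: Apoly_def admissible_def zero_less_mult_iff mult_less_0_iff)
      consider "x < r1" | "r1 \<le> x" "x < r2" | "r2 \<le> x" by linarith
      then show ?thesis
      proof cases
        case 1
        then have "u (x - r1) = \<i>" "u (x - r2) = \<i>" "(x - r1) * (x - r2) \<ge> 0"
          using A(2) by (auto simp: u_def zero_le_mult_iff)
        then show ?thesis using u A(1) by (auto simp: P_def Q_def)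
      next
        case 2
        then have "u (x - r1) = 1" "u (x - r2) = \<i>" "(x - r1) * (x - r2) \<le> 0"
          using A(2) by (auto simp: u_def mult_le_0_iff)
        then show ?thesis using u A(1) by (auto simp: P_def Q_def divide_nonpos_pos)
      next
        case 3
        then have "u (x - r1) = 1" "u (x - r2) = 1" "(x - r1) * (x - r2) \<ge> 0"
          using A(2) by (auto simp: u_def zero_le_mult_iff)
        then show ?thesis using u A(1) by (auto simp: P_def Q_def)
      qed
    next
      case 4
      then have u: "u (x - r1) = 1" "u (x - e1) = 1" "u (x - e2) = 1" "u (x - e3) = 1" "u (x - e4) = \<i>"
        using assms e12 e23 e34 by (auto simp: u_def admissible_def)
      have A: "Apoly e1 e2 e3 e4 x < 0" "x - r1 > 0"
        using 4 assms e12 e23 e34 by (auto simp: Apoly_def admissible_def zero_less_mult_iff mult_less_0_iff)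
      show ?thesis
      proof (cases "x < r2")
        case True
        then have "u (x - r2) = \<i>" "(x - r1) * (x - r2) \<le> 0" using A(2) by (auto simp: u_def mult_le_0_iff)
        then show ?thesis using u A(1) by (auto simp: P_def Q_def divide_nonpos_neg)
      next
        case False
        then have "u (x - r2) = 1" "(x - r1) * (x - r2) \<ge> 0" using A(2) by (auto simp: u_def zero_le_mult_iff)
        then show ?thesis using u A(1) by (auto simp: P_def Q_def divide_nonneg_neg)
      qed
    next
      case 5
      then have "u (x - r1) = 1" "u (x - r2) = 1" "u (x - e1) = 1" "u (x - e2) = 1" "u (x - e3) = 1" "u (x - e4) = 1"
        using assms e12 e23 e34 by (auto simp: u_def admissible_def)
      moreover have "Apoly e1 e2 e3 e4 x > 0" "(x - r1) * (x - r2) \<ge> 0"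
        using 5 assms e12 e23 e34 by (auto simp: Apoly_def admissible_def zero_less_mult_iff mult_less_0_iff zero_le_mult_iff)
      ultimately show ?thesis by (auto simp: P_def Q_def)
    qed
  qed
  then have "Im P * sqrt \<bar>Q\<bar> = - sqrt (max 0 (- Q))" by auto
  then show ?thesis using eq by (simp add: density_def Q_def)
qed

text \<open>The half-plane lemma applied to \<open>resolvent\<close>. The value does not depend on
  the roots, which is why the sum of the actions is constant.\<close>

lemma density_has_integral:
  assumes "admissible r1 r2"
  shows "(density r1 r2 has_integral pi) {e1..e4}"
proof -
  let ?E = "{e1, e2, e3, e4}"
  obtain W where W: "\<And>a b. W integrable_on {a..b}" "\<And>x. 1 / sqrt \<bar>Apoly e1 e2 e3 e4 x\<bar> \<le> W x"
    using inverse_sqrt_Apoly_dominated[OF e12 e23 e34] by blast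
  have "((\<lambda>x. - Im (resolvent r1 r2 (of_real x))) has_integral pi) {e1..e4}"
  proof (rule upper_half_plane_boundary_integral[where E = ?E and W = "\<lambda>\<rho> x. (\<rho> + 1 + \<bar>r1\<bar> + \<bar>r2\<bar>) * W x"
        and f = "resolvent r1 r2"])
    show "resolvent r1 r2 holomorphic_on {z. 0 < Im z}" by (rule resolvent_holomorphic)
    show "\<exists>R. \<forall>z. 0 < Im z \<longrightarrow> R \<le> cmod z \<longrightarrow> cmod (z * resolvent r1 r2 z - 1) \<le> \<epsilon>" if "\<epsilon> > 0" for \<epsilon>
    proof -
      have "\<forall>\<^sub>F z in inf at_infinity (principal {z. Im z > 0}). dist (z * resolvent r1 r2 z) 1 < \<epsilon>"
        using tendstoD[OF resolvent_asymptotics that] .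
      then show ?thesis
        by (auto simp: eventually_inf_principal eventually_at_infinity dist_norm intro: less_imp_le)
    qed
    show "(\<lambda>x. (\<rho> + 1 + \<bar>r1\<bar> + \<bar>r2\<bar>) * W x) integrable_on {- \<rho>..\<rho>}" for \<rho>
      by (intro integrable_on_mult_right W)
    show "cmod (resolvent r1 r2 (Complex x y)) \<le> (\<rho> + 1 + \<bar>r1\<bar> + \<bar>r2\<bar>) * W x"
      if "x \<notin> ?E" "\<bar>x\<bar> \<le> \<rho>" "0 < y" "y \<le> 1" for \<rho> x y
      using that by (intro order_trans[OF norm_resolvent_le[OF that]] mult_left_mono W) auto
    show "(\<lambda>n. resolvent r1 r2 (Complex x (1 / real (Suc n)))) \<longlonglongrightarrow> resolvent r1 r2 (of_real x)"
      if "x \<notin> ?E" for x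
      using that by (rule resolvent_limit)
    show "Im (resolvent r1 r2 (of_real x)) = 0" if "x \<notin> ?E" "x \<notin> {e1..e4}" for x
    proof -
      have "Apoly e1 e2 e3 e4 x > 0 \<and> (x - r1) * (x - r2) \<ge> 0"
      proof (cases "x < e1")
        case True
        then show ?thesis using assms e12 e23 e34
          by (auto simp: Apoly_def admissible_def zero_less_mult_iff mult_less_0_iff zero_le_mult_iff)
      next
        case False
        then have "x > e4" using that by auto
        then show ?thesis using assms e12 e23 e34
          by (auto simp: Apoly_def admissible_def zero_less_mult_iff mult_less_0_iff zero_le_mult_iff)
      qed
      then have "0 \<le> (x - r1) * (x - r2) / Apoly e1 e2 e3 e4 x" by auto
      then have "density r1 r2 x = 0"
        by (simp add: density_def max_def)
      then show ?thesis using Im_resolvent_real[OF assms that(1)] by simp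
    qed
  qed auto
  then show ?thesis
    by (rule has_integral_spike_finite[rotated 2, of _ _ _ ?E]) (use Im_resolvent_real[OF assms] in auto)
qed

end

section \<open>The roots on the symplectic leaf\<close>

text \<open>If \<open>m\<close> are the Pluecker coordinates of a plane, its first row \<open>u = (0, m12, m13, m14)\<close> lies in
  that plane. The left-hand side is, up to a positive factor, the Gram determinant of the plane for
  the diagonal form \<open>d\<close>, which is nonpositive as \<open>u\<close> is isotropic.\<close>

lemma Pluecker_isotropic_row_nonpos:
  fixes m12 m13 m14 m23 m24 m34 d1 d2 d3 d4 :: real
  assumes Pl: "m12 * m34 - m13 * m24 + m14 * m23 = 0"
    and iso: "m12\<^sup>2 * d2 + m13\<^sup>2 * d3 + m14\<^sup>2 * d4 = 0"
    and nz: "m12\<^sup>2 + m13\<^sup>2 + m14\<^sup>2 \<noteq> 0"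
  shows "m12\<^sup>2 * (d1 * d2) + m13\<^sup>2 * (d1 * d3) + m14\<^sup>2 * (d1 * d4)
    + m23\<^sup>2 * (d2 * d3) + m24\<^sup>2 * (d2 * d4) + m34\<^sup>2 * (d3 * d4) \<le> 0" (is "?S \<le> 0")
proof -
  define N where "N = m12\<^sup>2 + m13\<^sup>2 + m14\<^sup>2"
  \<comment> \<open>For the skew matrix \<open>M\<close> of \<open>m\<close> and its first row
    \<open>u\<close>, these are the last three entries of \<open>v = - M u\<close>; the first is
    \<open>- N\<close>. By the Pluecker relation, the bivector of \<open>u\<close> and
    \<open>v\<close> is \<open>N\<close> times \<open>m\<close>.\<close>
  define v2 v3 v4 where "v2 = - m13 * m23 - m14 * m24" and "v3 = m12 * m23 - m14 * m34"
    and "v4 = m12 * m24 + m13 * m34"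
  have 23: "m12 * v3 - m13 * v2 = N * m23" and 24: "m12 * v4 - m14 * v2 = N * m24"
    and 34: "m13 * v4 - m14 * v3 = N * m34"
    using Pl unfolding N_def v2_def v3_def v4_def by algebra+
  \<comment> \<open>The Gram determinant of \<open>u\<close> and \<open>v\<close> for the form
    \<open>d\<close>, expanded by Cauchy-Binet into squared minors. With \<open>u\<close> isotropic,
    only the negative of a square remains on the left.\<close>
  have "(m12\<^sup>2 * d2 + m13\<^sup>2 * d3 + m14\<^sup>2 * d4) * (N\<^sup>2 * d1 + v2\<^sup>2 * d2 + v3\<^sup>2 * d3 + v4\<^sup>2 * d4)
      - (m12 * v2 * d2 + m13 * v3 * d3 + m14 * v4 * d4)\<^sup>2
    = N\<^sup>2 * (m12\<^sup>2 * (d1 * d2) + m13\<^sup>2 * (d1 * d3) + m14\<^sup>2 * (d1 * d4))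
      + (m12 * v3 - m13 * v2)\<^sup>2 * (d2 * d3) + (m12 * v4 - m14 * v2)\<^sup>2 * (d2 * d4)
      + (m13 * v4 - m14 * v3)\<^sup>2 * (d3 * d4)"
    by algebra
  also have "\<dots> = N\<^sup>2 * ?S"
    unfolding 23 24 34 by (simp add: algebra_simps power_mult_distrib)
  finally have "N\<^sup>2 * ?S \<le> 0" unfolding iso by (metis diff_0 mult_zero_left neg_le_0_iff_le zero_le_power2)
  moreover have "N\<^sup>2 > 0" using nz by (simp add: N_def)
  ultimately show ?thesis by (simp add: mult_le_0_iff)
qed

lemma Rpoly_factorization:
  assumes "h > 0" "n1\<^sup>2 - 8 * h * n2 \<ge> 0"
  shows "Rpoly h n1 n2 z = 2 * h * ((z - root1 h n1 n2) * (z - root2 h n1 n2))"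
proof -
  define d where "d = sqrt (n1\<^sup>2 - 8 * h * n2)"
  have d: "d\<^sup>2 = n1\<^sup>2 - 8 * h * n2" using assms by (simp add: d_def)
  have s: "root1 h n1 n2 + root2 h n1 n2 = n1 / (2 * h)"
    using assms by (simp add: root1_def root2_def field_simps)
  have "root1 h n1 n2 * root2 h n1 n2 = (n1\<^sup>2 - d\<^sup>2) / (16 * h\<^sup>2)"
    unfolding root1_def root2_def d_def[symmetric] by (simp add: field_simps power2_eq_square)
  then have p: "root1 h n1 n2 * root2 h n1 n2 = n2 / (2 * h)"
    unfolding d using assms by (simp add: field_simps power2_eq_square)
  have "2 * h * ((z - root1 h n1 n2) * (z - root2 h n1 n2))
      = 2 * h * z\<^sup>2 - 2 * h * (root1 h n1 n2 + root2 h n1 n2) * z + 2 * h * (root1 h n1 n2 * root2 h n1 n2)"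
    by (simp add: algebra_simps power2_eq_square)
  then show ?thesis
    unfolding s p using assms by (simp add: Rpoly_def)
qed

text \<open>Completing the square expresses the discriminant as the square of the derivative at
  \<open>z\<close> minus \<open>8 * h\<close> times the value at \<open>z\<close>.\<close>

lemma Rpoly_nonpos_imp_discriminant:
  assumes "h > 0" "Rpoly h n1 n2 z \<le> 0"
  shows "n1\<^sup>2 - 8 * h * n2 \<ge> 0"
proof -
  have "n1\<^sup>2 - 8 * h * n2 = (4 * h * z - n1)\<^sup>2 - 8 * h * Rpoly h n1 n2 z"
    by (simp add: Rpoly_def algebra_simps power2_eq_square)
  moreover have "h * Rpoly h n1 n2 z \<le> 0" using assms by (simp add: mult_le_0_iff)
  ultimately show ?thesis using zero_le_power2[of "4 * h * z - n1"] by linarith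
qed

lemma root1_le_root2: "h > 0 \<Longrightarrow> n1\<^sup>2 - 8 * h * n2 \<ge> 0 \<Longrightarrow> root1 h n1 n2 \<le> root2 h n1 n2"
  by (simp add: root1_def root2_def divide_right_mono)

text \<open>The sphere equation distributes the leading term over the coordinates. In this shape
  \<open>Rpoly\<close> is the expression of \<open>Pluecker_isotropic_row_nonpos\<close> for the
  dual bivector and the form with entries \<open>z - e1\<close>, ..., \<open>z - e4\<close>.\<close>

lemma Rpoly_on_Mh:
  assumes "(l12, l13, l14, l23, l24, l34) \<in> Mh h" (is "?L \<in> _")
  shows "Rpoly h (eta1 e1 e2 e3 e4 ?L) (eta2 e1 e2 e3 e4 ?L) z =
     l12\<^sup>2 * ((z - e3) * (z - e4)) + l13\<^sup>2 * ((z - e2) * (z - e4)) + l14\<^sup>2 * ((z - e2) * (z - e3))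
   + l23\<^sup>2 * ((z - e1) * (z - e4)) + l24\<^sup>2 * ((z - e1) * (z - e3)) + l34\<^sup>2 * ((z - e1) * (z - e2))"
proof -
  have "2 * h = l12\<^sup>2 + l13\<^sup>2 + l14\<^sup>2 + l23\<^sup>2 + l24\<^sup>2 + l34\<^sup>2" using assms by (simp add: Mh_def)
  then show ?thesis
    by (simp add: Rpoly_def eta1_def eta2_def) (simp add: algebra_simps power2_eq_square)
qed

section \<open>Interlacing of the roots and realisation of admissible pairs\<close>

context branch_points
begin

text \<open>The leading coefficient is positive, so every point where \<open>Rpoly\<close> is
  nonpositive lies between the roots. One such point above \<open>e2\<close> and one below
  \<open>e3\<close> give the inner bounds; positivity outside \<open>{e1..e4}\<close> gives the
  outer ones.\<close>

lemma roots_admissible: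
  assumes h: "h > 0" and L: "L \<in> Mh h"
  defines "n1 \<equiv> eta1 e1 e2 e3 e4 L" and "n2 \<equiv> eta2 e1 e2 e3 e4 L"
  shows "n1\<^sup>2 - 8 * h * n2 \<ge> 0" "admissible (root1 h n1 n2) (root2 h n1 n2)"
proof -
  obtain l12 l13 l14 l23 l24 l34 where Leq: "L = (l12, l13, l14, l23, l24, l34)"
    by (metis surj_pair)
  have sum: "l12\<^sup>2 + l13\<^sup>2 + l14\<^sup>2 + l23\<^sup>2 + l24\<^sup>2 + l34\<^sup>2 = 2 * h"
    and Pl: "l12 * l34 - l13 * l24 + l14 * l23 = 0"
    using L by (auto simp: Leq Mh_def)
  have R: "Rpoly h n1 n2 z = l12\<^sup>2 * ((z - e3) * (z - e4)) + l13\<^sup>2 * ((z - e2) * (z - e4)) + l14\<^sup>2 * ((z - e2) * (z - e3))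
   + l23\<^sup>2 * ((z - e1) * (z - e4)) + l24\<^sup>2 * ((z - e1) * (z - e3)) + l34\<^sup>2 * ((z - e1) * (z - e2))" for z
    unfolding n1_def n2_def using Rpoly_on_Mh L by (simp add: Leq)
  \<comment> \<open>The witnesses below are Rayleigh quotients of rows of the dual bivector.\<close>
  have "\<exists>z\<ge>e2. Rpoly h n1 n2 z \<le> 0"
  proof (cases "l34\<^sup>2 + l24\<^sup>2 + l23\<^sup>2 = 0")
    case True
    then have "l34 = 0" "l24 = 0" "l23 = 0"
      using zero_le_power2[of l34] zero_le_power2[of l24] zero_le_power2[of l23]
      by (auto simp: add_nonneg_eq_0_iff)
    \<comment> \<open>With the row zero there is no Rayleigh quotient, but at \<open>e3\<close> only
      one term survives.\<close>
    then have "Rpoly h n1 n2 e3 = l13\<^sup>2 * ((e3 - e2) * (e3 - e4))" by (simp add: R)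
    also have "\<dots> \<le> 0" using e23 e34 by (simp add: mult_le_0_iff)
    finally show ?thesis using e23 by (intro exI[of _ e3]) auto
  next
    case False
    let ?N = "l34\<^sup>2 + l24\<^sup>2 + l23\<^sup>2"
    define z where "z = (l34\<^sup>2 * e2 + l24\<^sup>2 * e3 + l23\<^sup>2 * e4) / ?N"
    have N: "?N > 0" using False by (simp add: order_less_le)
    have zN: "?N * z = l34\<^sup>2 * e2 + l24\<^sup>2 * e3 + l23\<^sup>2 * e4" using False by (simp add: z_def)
    have "?N * e2 \<le> l34\<^sup>2 * e2 + l24\<^sup>2 * e3 + l23\<^sup>2 * e4"
      using e23 e34 by (simp add: distrib_right) (intro add_mono mult_left_mono, auto)
    then have "e2 \<le> z" using N zN by (metis mult_le_cancel_left_pos)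
    \<comment> \<open>Row 1 of the dual bivector has the entries \<open>l34\<close>,
      \<open>- l24\<close>, \<open>l23\<close>, and the choice of \<open>z\<close> makes it
      isotropic.\<close>
    moreover have "Rpoly h n1 n2 z \<le> 0"
      using Pluecker_isotropic_row_nonpos[of l34 l12 "- l24" "- l13" l23 l14 "z - e2" "z - e3" "z - e4" "z - e1"]
        Pl zN False by (simp add: R algebra_simps)
    ultimately show ?thesis by blast
  qed
  then obtain z where z: "e2 \<le> z" "Rpoly h n1 n2 z \<le> 0" by blast
  have "\<exists>z\<le>e3. Rpoly h n1 n2 z \<le> 0"
  proof (cases "l13\<^sup>2 + l12\<^sup>2 + l23\<^sup>2 = 0")
    case True
    then have "l13 = 0" "l12 = 0" "l23 = 0"
      using zero_le_power2[of l13] zero_le_power2[of l12] zero_le_power2[of l23]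
      by (auto simp: add_nonneg_eq_0_iff)
    then have "Rpoly h n1 n2 e2 = l24\<^sup>2 * ((e2 - e1) * (e2 - e3))" by (simp add: R)
    also have "\<dots> \<le> 0" using e12 e23 by (simp add: mult_le_0_iff)
    finally show ?thesis using e23 by (intro exI[of _ e2]) auto
  next
    case False
    let ?N = "l13\<^sup>2 + l12\<^sup>2 + l23\<^sup>2"
    define z where "z = (l13\<^sup>2 * e2 + l12\<^sup>2 * e3 + l23\<^sup>2 * e1) / ?N"
    have N: "?N > 0" using False by (simp add: order_less_le)
    have zN: "?N * z = l13\<^sup>2 * e2 + l12\<^sup>2 * e3 + l23\<^sup>2 * e1" using False by (simp add: z_def)
    have "l13\<^sup>2 * e2 + l12\<^sup>2 * e3 + l23\<^sup>2 * e1 \<le> ?N * e3"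
      using e12 e23 by (simp add: distrib_right) (intro add_mono mult_left_mono, auto)
    then have "z \<le> e3" using N zN by (metis mult_le_cancel_left_pos)
    \<comment> \<open>Now row 4 of the dual bivector is used, with the indices 1 and 4 exchanged in
      the lemma.\<close>
    moreover have "Rpoly h n1 n2 z \<le> 0"
      using Pluecker_isotropic_row_nonpos[of l13 l24 "- l12" "- l34" "- l23" l14 "z - e2" "z - e3" "z - e1" "z - e4"]
        Pl zN False by (simp add: R algebra_simps)
    ultimately show ?thesis by blast
  qed
  then obtain z' where z': "z' \<le> e3" "Rpoly h n1 n2 z' \<le> 0" by blast
  show disc: "n1\<^sup>2 - 8 * h * n2 \<ge> 0"
    using Rpoly_nonpos_imp_discriminant[OF h z(2)] .
  let ?r1 = "root1 h n1 n2" and ?r2 = "root2 h n1 n2"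
  note fac = Rpoly_factorization[OF h disc]
  have le: "?r1 \<le> ?r2" using root1_le_root2[OF h disc] .
  have between: "?r1 \<le> t \<and> t \<le> ?r2" if "Rpoly h n1 n2 t \<le> 0" for t
    using that le h unfolding fac by (auto simp: mult_le_0_iff)
  \<comment> \<open>At distance at least \<open>c\<close> outside \<open>{e1..e4}\<close>, both
    factors of each product have the same sign, so each product is at least the square of
    \<open>c\<close>.\<close>
  have pos: "Rpoly h n1 n2 t > 0" if c: "\<bar>t - e1\<bar> \<ge> c" "\<bar>t - e4\<bar> \<ge> c" "c > 0" "t < e1 \<or> t > e4" for t c
  proof -
    have "c\<^sup>2 \<le> (t - e) * (t - e')" if "e \<in> {e1, e2, e3, e4}" "e' \<in> {e1, e2, e3, e4}" for e e'
    proof -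
      have "c \<le> \<bar>t - e\<bar>" "c \<le> \<bar>t - e'\<bar>" using that c e12 e23 e34 by auto
      then have "c * c \<le> \<bar>t - e\<bar> * \<bar>t - e'\<bar>" using \<open>c > 0\<close> by (intro mult_mono) auto
      also have "\<dots> = (t - e) * (t - e')"
        using c(4) that e12 e23 e34 by (auto simp: abs_if algebra_simps)
      finally show ?thesis by (simp add: power2_eq_square)
    qed
    then have "l12\<^sup>2 * c\<^sup>2 + l13\<^sup>2 * c\<^sup>2 + l14\<^sup>2 * c\<^sup>2 + l23\<^sup>2 * c\<^sup>2 + l24\<^sup>2 * c\<^sup>2 + l34\<^sup>2 * c\<^sup>2 \<le> Rpoly h n1 n2 t"
      unfolding R by (intro add_mono mult_left_mono) auto
    moreover have "l12\<^sup>2 * c\<^sup>2 + l13\<^sup>2 * c\<^sup>2 + l14\<^sup>2 * c\<^sup>2 + l23\<^sup>2 * c\<^sup>2 + l24\<^sup>2 * c\<^sup>2 + l34\<^sup>2 * c\<^sup>2 = 2 * h * c\<^sup>2"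
      by (simp add: sum[symmetric] distrib_right)
    ultimately show ?thesis using h \<open>c > 0\<close> by (smt (verit) mult_pos_pos zero_less_power)
  qed
  have "e1 \<le> ?r1"
  proof (rule ccontr)
    assume "\<not> e1 \<le> ?r1"
    then have "Rpoly h n1 n2 ?r1 > 0" using pos[of "e1 - ?r1" ?r1] e12 e23 e34 by auto
    then show False unfolding fac by simp
  qed
  moreover have "?r2 \<le> e4"
  proof (rule ccontr)
    assume "\<not> ?r2 \<le> e4"
    then have "Rpoly h n1 n2 ?r2 > 0" using pos[of "?r2 - e4" ?r2] e12 e23 e34 by auto
    then show False unfolding fac by simp
  qed
  ultimately show "admissible ?r1 ?r2"
    using le between[OF z(2)] between[OF z'(2)] z(1) z'(1) by (auto simp: admissible_def)
qed

text \<open>Planes spanned by one vector of the first and third and one vector of the second and fourth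
  coordinate axes already realise all admissible pairs.\<close>

lemma admissible_realised:
  assumes h: "h > 0" and adm: "admissible r1 r2"
  obtains L where "L \<in> Mh h" "root1 h (eta1 e1 e2 e3 e4 L) (eta2 e1 e2 e3 e4 L) = r1"
    "root2 h (eta1 e1 e2 e3 e4 L) (eta2 e1 e2 e3 e4 L) = r2"
proof -
  define a b where "a = (r1 - e1) / (e3 - e1)" and "b = (r2 - e2) / (e4 - e2)"
  have ab: "0 \<le> a" "a \<le> 1" "0 \<le> b" "b \<le> 1"
    using adm e12 e23 e34 by (auto simp: a_def b_def admissible_def field_simps)
  have r: "r1 = a * e3 + (1 - a) * e1" "r2 = b * e4 + (1 - b) * e2"
  proof -
    have "a * (e3 - e1) = r1 - e1" "b * (e4 - e2) = r2 - e2" using e12 e23 e34 by (auto simp: a_def b_def)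
    then show "r1 = a * e3 + (1 - a) * e1" "r2 = b * e4 + (1 - b) * e2" by (simp_all add: algebra_simps)
  qed
  \<comment> \<open>The Pluecker coordinates of the vectors
    \<open>(sqrt a, 0, sqrt (1 - a), 0)\<close> and \<open>(0, sqrt b, 0, sqrt (1 - b))\<close>,
    scaled by \<open>sqrt (2 * h)\<close>. On the orthogonal plane, the compression is diagonal with
    eigenvalues the convex combinations \<open>r1\<close> and \<open>r2\<close>.\<close>
  define L where "L = (sqrt (2 * h * a * b), 0::real, sqrt (2 * h * a * (1 - b)),
     - sqrt (2 * h * (1 - a) * b), 0::real, sqrt (2 * h * (1 - a) * (1 - b)))"
  have sq: "(sqrt (2 * h * a * b))\<^sup>2 = 2 * h * a * b" "(sqrt (2 * h * a * (1 - b)))\<^sup>2 = 2 * h * a * (1 - b)"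
    "(sqrt (2 * h * (1 - a) * b))\<^sup>2 = 2 * h * (1 - a) * b"
    "(sqrt (2 * h * (1 - a) * (1 - b)))\<^sup>2 = 2 * h * (1 - a) * (1 - b)"
    using h ab by simp_all
  have "sqrt (2 * h * a * b) * sqrt (2 * h * (1 - a) * (1 - b))
      = sqrt (2 * h * a * (1 - b)) * sqrt (2 * h * (1 - a) * b)"
    by (simp only: real_sqrt_mult[symmetric]) (simp add: algebra_simps)
  then have "L \<in> Mh h" unfolding Mh_def L_def by (simp add: sq del: real_sqrt_pow2_iff) (simp add: algebra_simps)
  moreover have n1: "eta1 e1 e2 e3 e4 L = 2 * h * (r1 + r2)"
    unfolding eta1_def L_def r by (simp add: sq del: real_sqrt_pow2_iff) (simp add: algebra_simps)
  moreover have n2: "eta2 e1 e2 e3 e4 L = 2 * h * (r1 * r2)"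
    unfolding eta2_def L_def r by (simp add: sq del: real_sqrt_pow2_iff) (simp add: algebra_simps)
  moreover have "sqrt ((2 * h * (r1 + r2))\<^sup>2 - 8 * h * (2 * h * (r1 * r2))) = 2 * h * (r2 - r1)"
  proof -
    have "(2 * h * (r1 + r2))\<^sup>2 - 8 * h * (2 * h * (r1 * r2)) = (2 * h * (r2 - r1))\<^sup>2"
      by (simp add: power2_eq_square algebra_simps)
    then show ?thesis using h adm by (simp add: admissible_def)
  qed
  ultimately show ?thesis
    using h by (intro that[of L]) (auto simp: root1_def root2_def field_simps)
qed

end

section \<open>Surjectivity\<close>

text \<open>The coordinates \<open>p\<close>, \<open>q\<close>, \<open>s - p - q\<close> map a box to a triangle so that each edge of the
  box lands on the line of an edge of the triangle. The signs in the clamped map \<open>T\<close> are such that a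
  fixed point on the boundary of the box is also a solution.\<close>

lemma Brouwer_triangle:
  fixes p q :: "real \<times> real \<Rightarrow> real" and x0 x1 y0 y1 a c s :: real
  assumes box: "x0 \<le> x1" "y0 \<le> y1"
    and cont: "continuous_on ({x0..x1} \<times> {y0..y1}) p" "continuous_on ({x0..x1} \<times> {y0..y1}) q"
    and left: "\<And>y. y \<in> {y0..y1} \<Longrightarrow> p (x0, y) = 0"
    and top: "\<And>x. x \<in> {x0..x1} \<Longrightarrow> q (x, y1) = 0"
    and right: "\<And>y. y \<in> {y0..y1} \<Longrightarrow> p (x1, y) + q (x1, y) = s"
    and bottom: "\<And>x. x \<in> {x0..x1} \<Longrightarrow> p (x, y0) + q (x, y0) = s"
    and ac: "a \<ge> 0" "c \<ge> 0" "a + c \<le> s"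
  obtains x y where "x \<in> {x0..x1}" "y \<in> {y0..y1}" "p (x, y) = a" "q (x, y) = c"
proof -
  let ?S = "{x0..x1} \<times> {y0..y1}"
  define T where "T = (\<lambda>z. (max x0 (min x1 (fst z - (p z - a))), max y0 (min y1 (snd z + (q z - c)))))"
  have "compact ?S" "convex ?S" "?S \<noteq> {}"
    using box by (auto intro: compact_Times convex_Times)
  moreover have "continuous_on ?S T"
    unfolding T_def by (intro continuous_intros cont)
  moreover have "T \<in> ?S \<rightarrow> ?S"
    using box by (auto simp: T_def)
  ultimately obtain z where z: "z \<in> ?S" "T z = z"
    using brouwer by blast
  obtain x y where xy: "z = (x, y)" by fastforce
  have mem: "x \<in> {x0..x1}" "y \<in> {y0..y1}" using z xy by auto
  have fx: "max x0 (min x1 (x - (p (x, y) - a))) = x" and fy: "max y0 (min y1 (y + (q (x, y) - c))) = y"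
    using z xy by (auto simp: T_def)
  have X: "x = x0 \<and> p (x, y) \<ge> a \<or> x = x1 \<and> p (x, y) \<le> a \<or> p (x, y) = a"
    using fx mem by (auto simp: max_def min_def split: if_splits)
  have Y: "y = y0 \<and> q (x, y) \<le> c \<or> y = y1 \<and> q (x, y) \<ge> c \<or> q (x, y) = c"
    using fy mem by (auto simp: max_def min_def split: if_splits)
  \<comment> \<open>On the left and top edges the inequality and the sign of \<open>a\<close> or
    \<open>c\<close> force equality. On the right and bottom edges \<open>p + q = s\<close> together
    with \<open>a + c \<le> s\<close> does so.\<close>
  have "p (x, y) = a \<and> q (x, y) = c"
  proof -
    have "x = x0 \<Longrightarrow> p (x, y) = 0" "y = y1 \<Longrightarrow> q (x, y) = 0"
      "x = x1 \<Longrightarrow> p (x, y) + q (x, y) = s" "y = y0 \<Longrightarrow> p (x, y) + q (x, y) = s"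
      using left right top bottom mem by auto
    with X Y ac show ?thesis by argo
  qed
  then show ?thesis using that mem by blast
qed

section \<open>The actions as integrals of the density\<close>

context branch_points
begin

lemma density_integrable:
  assumes "admissible r1 r2" "e1 \<le> a" "b \<le> e4"
  shows "density r1 r2 integrable_on {a..b}"
  by (rule integrable_on_subinterval[OF has_integral_integrable[OF density_has_integral[OF assms(1)]]])
     (use assms in auto)

lemma integral_density_sum:
  assumes "admissible r1 r2"
  shows "integral {e1..e2} (density r1 r2) + integral {e2..e3} (density r1 r2) + integral {e3..e4} (density r1 r2) = pi"
proof -
  have "integral {e1..e2} (density r1 r2) + integral {e2..e3} (density r1 r2) = integral {e1..e3} (density r1 r2)"
    using e12 e23 e34 density_integrable[OF assms]
    by (intro Henstock_Kurzweil_Integration.integral_combine) auto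
  moreover have "integral {e1..e3} (density r1 r2) + integral {e3..e4} (density r1 r2) = integral {e1..e4} (density r1 r2)"
    using e12 e23 e34 density_integrable[OF assms]
    by (intro Henstock_Kurzweil_Integration.integral_combine) auto
  ultimately show ?thesis using integral_unique[OF density_has_integral[OF assms]] by simp
qed

lemma integral_density_nonneg:
  assumes "admissible r1 r2" "e1 \<le> a" "b \<le> e4"
  shows "integral {a..b} (density r1 r2) \<ge> 0"
  using density_integrable[OF assms] density_nonneg by (intro integral_nonneg) auto

lemma integral_density_restrict:
  assumes "u \<le> a" "b \<le> v"
    and inside: "\<And>s. a \<le> s \<Longrightarrow> s \<le> b \<Longrightarrow> - ((s - r1) * (s - r2)) / Apoly e1 e2 e3 e4 s \<ge> 0"
    and outside: "\<And>s. u \<le> s \<Longrightarrow> s \<le> v \<Longrightarrow> s < a \<or> b < s \<Longrightarrow> - ((s - r1) * (s - r2)) / Apoly e1 e2 e3 e4 s \<le> 0"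
  shows "integral {u..v} (density r1 r2) = integral {a..b} (\<lambda>s. sqrt (- ((s - r1) * (s - r2)) / Apoly e1 e2 e3 e4 s))"
proof -
  let ?\<phi> = "\<lambda>s. sqrt (- ((s - r1) * (s - r2)) / Apoly e1 e2 e3 e4 s)"
  have "integral {u..v} (density r1 r2) = integral {u..v} (\<lambda>s. if s \<in> {a..b} then ?\<phi> s else 0)"
  proof (rule Henstock_Kurzweil_Integration.integral_cong)
    fix s assume s: "s \<in> {u..v}"
    show "density r1 r2 s = (if s \<in> {a..b} then ?\<phi> s else 0)"
    proof (cases "s \<in> {a..b}")
      case True
      then show ?thesis using inside[of s] by (simp add: density_def max_absorb2)
    next
      case False
      then show ?thesis using outside[of s] s by (auto simp: density_def max_absorb1)
    qed
  qed
  also have "\<dots> = integral ({a..b} \<inter> {u..v}) ?\<phi>" by (rule integral_restrict_Int)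
  also have "{a..b} \<inter> {u..v} = {a..b}" using assms(1,2) by auto
  finally show ?thesis .
qed

lemma Apoly_signs:
  shows "s \<in> {e1..e2} \<Longrightarrow> Apoly e1 e2 e3 e4 s \<le> 0"
    and "s \<in> {e2..e3} \<Longrightarrow> Apoly e1 e2 e3 e4 s \<ge> 0"
    and "s \<in> {e3..e4} \<Longrightarrow> Apoly e1 e2 e3 e4 s \<le> 0"
  using e12 e23 e34 unfolding Apoly_def
  by (simp_all add: mult_nonneg_nonpos mult_nonneg_nonneg mult_nonpos_nonpos mult_nonneg_nonpos2)

text \<open>The sign of the radicand follows from that of \<open>Apoly\<close> on each interval and
  the position of the roots. The clamped limits cover either position of a root relative to
  \<open>e2\<close> or \<open>e3\<close>, including the collapse of a band to a point.\<close>

lemma integral_density_bands: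
  assumes adm: "admissible r1 r2"
  defines "\<phi> \<equiv> \<lambda>s. sqrt (- ((s - r1) * (s - r2)) / Apoly e1 e2 e3 e4 s)"
  shows "integral {e1..e2} (density r1 r2) = integral {e1..min r1 e2} \<phi>"
    and "integral {e2..e3} (density r1 r2) = integral {max r1 e2..min r2 e3} \<phi>"
    and "integral {e3..e4} (density r1 r2) = integral {max r2 e3..e4} \<phi>"
proof -
  have r: "e1 \<le> r1" "r1 \<le> e3" "e2 \<le> r2" "r2 \<le> e4" "r1 \<le> r2" using adm by (auto simp: admissible_def)
  show "integral {e1..e2} (density r1 r2) = integral {e1..min r1 e2} \<phi>"
    unfolding \<phi>_def
  proof (rule integral_density_restrict)
    fix s assume s: "e1 \<le> s" "s \<le> min r1 e2"
    then have "(s - r1) * (s - r2) \<ge> 0" using r by (intro mult_nonpos_nonpos) auto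
    then show "- ((s - r1) * (s - r2)) / Apoly e1 e2 e3 e4 s \<ge> 0"
      using Apoly_signs(1)[of s] s by (intro divide_nonpos_nonpos) auto
  next
    fix s assume s: "e1 \<le> s" "s \<le> e2" "s < e1 \<or> min r1 e2 < s"
    then have "(s - r1) * (s - r2) \<le> 0" using r by (intro mult_nonneg_nonpos) auto
    then show "- ((s - r1) * (s - r2)) / Apoly e1 e2 e3 e4 s \<le> 0"
      using Apoly_signs(1)[of s] s by (intro divide_nonneg_nonpos) auto
  qed auto
  show "integral {e2..e3} (density r1 r2) = integral {max r1 e2..min r2 e3} \<phi>"
    unfolding \<phi>_def
  proof (rule integral_density_restrict)
    fix s assume s: "max r1 e2 \<le> s" "s \<le> min r2 e3"
    then have "(s - r1) * (s - r2) \<le> 0" using r by (intro mult_nonneg_nonpos) auto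
    then show "- ((s - r1) * (s - r2)) / Apoly e1 e2 e3 e4 s \<ge> 0"
      using Apoly_signs(2)[of s] s by (intro divide_nonneg_nonneg) auto
  next
    fix s assume s: "e2 \<le> s" "s \<le> e3" "s < max r1 e2 \<or> min r2 e3 < s"
    then have "s < r1 \<or> s > r2" by auto
    then have "(s - r1) * (s - r2) \<ge> 0" using r by (auto simp: zero_le_mult_iff)
    then show "- ((s - r1) * (s - r2)) / Apoly e1 e2 e3 e4 s \<le> 0"
      using Apoly_signs(2)[of s] s by (intro divide_nonpos_nonneg) auto
  qed auto
  show "integral {e3..e4} (density r1 r2) = integral {max r2 e3..e4} \<phi>"
    unfolding \<phi>_def
  proof (rule integral_density_restrict)
    fix s assume s: "max r2 e3 \<le> s" "s \<le> e4"
    then have "(s - r1) * (s - r2) \<ge> 0" using r by (intro mult_nonneg_nonneg) auto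
    then show "- ((s - r1) * (s - r2)) / Apoly e1 e2 e3 e4 s \<ge> 0"
      using Apoly_signs(3)[of s] s by (intro divide_nonpos_nonpos) auto
  next
    fix s assume s: "e3 \<le> s" "s \<le> e4" "s < max r2 e3 \<or> e4 < s"
    then have "(s - r1) * (s - r2) \<le> 0" using r by (intro mult_nonneg_nonpos) auto
    then show "- ((s - r1) * (s - r2)) / Apoly e1 e2 e3 e4 s \<le> 0"
      using Apoly_signs(3)[of s] s by (intro divide_nonneg_nonpos) auto
  qed auto
qed

text \<open>Factoring \<open>Rpoly\<close> pulls \<open>sqrt (h / 2)\<close> out of the integrand,
  and \<open>2 * sqrt (h / 2) = sqrt (2 * h)\<close>.\<close>

lemma action_map_eq:
  assumes h: "h > 0" and disc: "(eta1 e1 e2 e3 e4 L)\<^sup>2 - 8 * h * eta2 e1 e2 e3 e4 L \<ge> 0"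
    and r: "root1 h (eta1 e1 e2 e3 e4 L) (eta2 e1 e2 e3 e4 L) = r1"
      "root2 h (eta1 e1 e2 e3 e4 L) (eta2 e1 e2 e3 e4 L) = r2"
    and adm: "admissible r1 r2"
  shows "action_map e1 e2 e3 e4 h L = (sqrt (2 * h) / pi * integral {e1..e2} (density r1 r2),
     sqrt (2 * h) / pi * integral {e2..e3} (density r1 r2), sqrt (2 * h) / pi * integral {e3..e4} (density r1 r2))"
proof -
  let ?\<phi> = "\<lambda>s. sqrt (- ((s - r1) * (s - r2)) / Apoly e1 e2 e3 e4 s)"
  have "sqrt (- Rpoly h (eta1 e1 e2 e3 e4 L) (eta2 e1 e2 e3 e4 L) s / (4 * Apoly e1 e2 e3 e4 s))
      = sqrt (h / 2) * ?\<phi> s" for s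
  proof -
    have "- (2 * h * n) / (4 * A) = h / 2 * (- n / A)" for n A :: real by simp
    then show ?thesis
      unfolding Rpoly_factorization[OF h disc] r real_sqrt_mult[symmetric] by metis
  qed
  moreover have "2 / pi * integral S (\<lambda>s. sqrt (h / 2) * ?\<phi> s) = sqrt (2 * h) / pi * integral S ?\<phi>" for S
  proof -
    have "sqrt (2 * h) = sqrt (2\<^sup>2 * (h / 2))" by simp
    also have "\<dots> = 2 * sqrt (h / 2)" by (simp only: real_sqrt_mult real_sqrt_abs)
    finally show ?thesis by simp
  qed
  ultimately show ?thesis
    unfolding integral_density_bands[OF adm] by (simp add: action_map_def Let_def r)
qed

text \<open>Dominated convergence with a majorant independent of the roots. The minimum retracts the
  box onto the admissible region, so that Brouwer's theorem can be used on a rectangle.\<close>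

lemma integral_density_continuous:
  assumes ab: "e1 \<le> a" "b \<le> e4"
  shows "continuous_on ({e1..e3} \<times> {e2..e4}) (\<lambda>z. integral {a..b} (density (min (fst z) (snd z)) (snd z)))"
  unfolding continuous_on_sequentially
proof (intro allI ballI impI)
  fix X z assume z: "z \<in> {e1..e3} \<times> {e2..e4}"
    and X: "(\<forall>n. X n \<in> {e1..e3} \<times> {e2..e4}) \<and> X \<longlonglongrightarrow> z"
  obtain W where W: "\<And>a b. W integrable_on {a..b}" "\<And>x. 1 / sqrt \<bar>Apoly e1 e2 e3 e4 x\<bar> \<le> W x"
    using inverse_sqrt_Apoly_dominated[OF e12 e23 e34] by blast
  let ?D = "\<lambda>z. density (min (fst z) (snd z)) (snd z)"
  have adm: "admissible (min (fst z) (snd z)) (snd z)" if "z \<in> {e1..e3} \<times> {e2..e4}" for z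
    using that e12 e23 e34 by (auto simp: admissible_def)
  have bound: "norm (density r1 r2 s) \<le> (e4 - e1) * W s" if "admissible r1 r2" "s \<in> {a..b}" for r1 r2 s
  proof -
    have r: "\<bar>s - r1\<bar> \<le> e4 - e1" "\<bar>s - r2\<bar> \<le> e4 - e1" using that ab e12 e23 e34 by (auto simp: admissible_def)
    have "max 0 (- ((s - r1) * (s - r2)) / Apoly e1 e2 e3 e4 s) \<le> \<bar>- ((s - r1) * (s - r2)) / Apoly e1 e2 e3 e4 s\<bar>"
      by linarith
    also have "\<dots> = (\<bar>s - r1\<bar> * \<bar>s - r2\<bar>) / \<bar>Apoly e1 e2 e3 e4 s\<bar>" by (simp add: abs_mult)
    also have "\<dots> \<le> ((e4 - e1) * (e4 - e1)) / \<bar>Apoly e1 e2 e3 e4 s\<bar>"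
      using r e12 e23 e34 by (intro divide_right_mono mult_mono) auto
    finally have "density r1 r2 s \<le> sqrt (((e4 - e1) * (e4 - e1)) / \<bar>Apoly e1 e2 e3 e4 s\<bar>)"
      unfolding density_def by (rule real_sqrt_le_mono)
    also have "\<dots> = (e4 - e1) * (1 / sqrt \<bar>Apoly e1 e2 e3 e4 s\<bar>)"
      using e12 e23 e34 by (simp add: real_sqrt_divide)
    also have "\<dots> \<le> (e4 - e1) * W s" using e12 e23 e34 by (intro mult_left_mono W) auto
    finally show ?thesis using density_nonneg by simp
  qed
  have "(\<lambda>n. integral {a..b} (?D (X n))) \<longlonglongrightarrow> integral {a..b} (?D z)"
  proof (rule dominated_convergence(2)[where h = "\<lambda>s. (e4 - e1) * W s"])
    show "?D (X n) integrable_on {a..b}" for n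
      using X adm by (intro density_integrable ab) auto
    show "(\<lambda>s. (e4 - e1) * W s) integrable_on {a..b}"
      by (intro integrable_on_mult_right W)
    show "norm (?D (X n) s) \<le> (e4 - e1) * W s" if "s \<in> {a..b}" for n s
      using X adm that by (intro bound) auto
    have "(\<lambda>n. fst (X n)) \<longlonglongrightarrow> fst z" "(\<lambda>n. snd (X n)) \<longlonglongrightarrow> snd z"
      using X by (auto intro: tendsto_fst tendsto_snd)
    \<comment> \<open>As multiplication by a constant inverse, the quotient converges at the branch
      points too, where that inverse is 0.\<close>
    then show "(\<lambda>n. ?D (X n) s) \<longlonglongrightarrow> ?D z s" for s
      unfolding density_def divide_inverse
      by (intro tendsto_real_sqrt tendsto_max tendsto_min tendsto_mult tendsto_minus tendsto_diff tendsto_const)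
  qed
  then show "((\<lambda>z. integral {a..b} (?D z)) \<circ> X) \<longlonglongrightarrow> integral {a..b} (?D z)"
    by (simp add: o_def)
qed

text \<open>On the left edge of the box the first band collapses, on the top edge the third, and on
  the right and bottom edges the middle one. With total mass \<open>pi\<close> these are the edge
  conditions of \<open>Brouwer_triangle\<close>.\<close>

lemma integral_density_surj:
  assumes "J1 \<ge> 0" "J2 \<ge> 0" "J3 \<ge> 0" "J1 + J2 + J3 = pi"
  obtains r1 r2 where "admissible r1 r2" "integral {e1..e2} (density r1 r2) = J1"
    "integral {e2..e3} (density r1 r2) = J2" "integral {e3..e4} (density r1 r2) = J3"
proof -
  let ?D = "\<lambda>z. density (min (fst z) (snd z)) (snd z)"
  let ?p = "\<lambda>z. integral {e1..e2} (?D z)" and ?q = "\<lambda>z. integral {e3..e4} (?D z)"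
  have adm: "admissible (min x y) y" if "x \<in> {e1..e3}" "y \<in> {e2..e4}" for x y
    using that e12 e23 e34 by (auto simp: admissible_def)
  have e: "e1 \<in> {e1..e3}" "e3 \<in> {e1..e3}" "e2 \<in> {e2..e4}" "e4 \<in> {e2..e4}" using e12 e23 e34 by auto
  obtain x y where xy: "x \<in> {e1..e3}" "y \<in> {e2..e4}" "?p (x, y) = J1" "?q (x, y) = J3"
  proof (rule Brouwer_triangle[of e1 e3 e2 e4 ?p ?q pi J1 J3])
    show "continuous_on ({e1..e3} \<times> {e2..e4}) ?p" "continuous_on ({e1..e3} \<times> {e2..e4}) ?q"
      using e12 e23 e34 by (intro integral_density_continuous; simp)+
    show "?p (e1, y) = 0" if "y \<in> {e2..e4}" for y
      using integral_density_bands(1)[OF adm[OF e(1) that]] that e12 by (simp add: min_absorb1)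
    show "?q (x, e4) = 0" if "x \<in> {e1..e3}" for x
      using integral_density_bands(3)[OF adm[OF that e(4)]] e34 by (simp add: max_absorb1)
    show "?p (e3, y) + ?q (e3, y) = pi" if "y \<in> {e2..e4}" for y
    proof -
      \<comment> \<open>For \<open>y < e3\<close> both roots equal \<open>y\<close>; otherwise the
        smaller root is \<open>e3\<close>. In either case the middle band is a single point.\<close>
      have "max (min e3 y) e2 = min y e3" using that e23 by auto
      then show ?thesis
        using integral_density_bands(2)[OF adm[OF e(2) that]] integral_density_sum[OF adm[OF e(2) that]] by simp
    qed
    show "?p (x, e2) + ?q (x, e2) = pi" if "x \<in> {e1..e3}" for x
    proof -
      have "max (min x e2) e2 = e2" "min e2 e3 = e2" using e23 by auto
      then show ?thesis
        using integral_density_bands(2)[OF adm[OF that e(3)]] integral_density_sum[OF adm[OF that e(3)]] by simp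
    qed
  qed (use assms e12 e23 e34 in auto)
  with integral_density_sum[OF adm[OF xy(1,2)]] assms show ?thesis
    using that[OF adm[OF xy(1,2)]] by simp
qed

end

theorem theorem6:
  fixes e1 e2 e3 e4 h :: real
  assumes "e1 < e2" "e2 < e3" "e3 < e4" "h > 0"
  shows "action_map e1 e2 e3 e4 h ` Mh h = triangle h"
proof -
  interpret branch_points e1 e2 e3 e4 using assms by unfold_locales
  let ?c = "sqrt (2 * h) / pi"
  have c: "?c > 0" using assms by simp
  show ?thesis
  proof (intro equalityI subsetI)
    fix J assume "J \<in> action_map e1 e2 e3 e4 h ` Mh h"
    then obtain L where L: "L \<in> Mh h" "J = action_map e1 e2 e3 e4 h L" by auto
    define r1 r2 where "r1 = root1 h (eta1 e1 e2 e3 e4 L) (eta2 e1 e2 e3 e4 L)"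
      and "r2 = root2 h (eta1 e1 e2 e3 e4 L) (eta2 e1 e2 e3 e4 L)"
    note adm = roots_admissible[OF assms(4) L(1), folded r1_def r2_def]
    have "?c * integral {e1..e2} (density r1 r2) + ?c * integral {e2..e3} (density r1 r2)
        + ?c * integral {e3..e4} (density r1 r2) = ?c * pi"
      unfolding integral_density_sum[OF adm(2), symmetric] by (simp only: distrib_left)
    then show "J \<in> triangle h"
      unfolding L(2) action_map_eq[OF assms(4) adm(1) r1_def[symmetric] r2_def[symmetric] adm(2)] triangle_def
      using c assms integral_density_nonneg[OF adm(2)] by simp
  next
    fix J assume "J \<in> triangle h"
    then obtain J1 J2 J3 where J: "J = (J1, J2, J3)" "J1 \<ge> 0" "J2 \<ge> 0" "J3 \<ge> 0" "J1 + J2 + J3 = sqrt (2 * h)"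
      by (auto simp: triangle_def)
    \<comment> \<open>Rescaling by \<open>?c\<close> matches the side sum
      \<open>sqrt (2 * h)\<close> with the mass \<open>pi\<close> of the density.\<close>
    have "J1 / ?c + J2 / ?c + J3 / ?c = pi"
      unfolding add_divide_distrib[symmetric] J(5) using assms by simp
    then obtain r1 r2 where r: "admissible r1 r2" "integral {e1..e2} (density r1 r2) = J1 / ?c"
        "integral {e2..e3} (density r1 r2) = J2 / ?c" "integral {e3..e4} (density r1 r2) = J3 / ?c"
      using integral_density_surj[of "J1 / ?c" "J2 / ?c" "J3 / ?c"] J c by (metis divide_nonneg_pos)
    obtain L where L: "L \<in> Mh h" "root1 h (eta1 e1 e2 e3 e4 L) (eta2 e1 e2 e3 e4 L) = r1"
        "root2 h (eta1 e1 e2 e3 e4 L) (eta2 e1 e2 e3 e4 L) = r2"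
      using admissible_realised[OF assms(4) r(1)] by blast
    have "action_map e1 e2 e3 e4 h L = J"
      unfolding action_map_eq[OF assms(4) roots_admissible(1)[OF assms(4) L(1)] L(2,3) r(1)] J(1) r(2-4)
      using assms(4) by simp
    with L(1) show "J \<in> action_map e1 e2 e3 e4 h ` Mh h" by blast
  qed
qed

end
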